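(* Let $\mathbb{A}$ and $\mathbb{B}$ be sets of pointed Kripke-models for $\Phi$ and let $m$ and $k$ be natural numbers. Then the following conditions are equivalent: (1) Player S has a winning strategy in the formula size game $\mathrm{FS}_{m,k}(\mathbb{A},\mathbb{B})$. (2) There is a formula $\varphi\in\mathrm{ML}(\Phi)$ such that $\mathrm{ms}(\varphi)\le m$, $\mathrm{cs}(\varphi)\le k$ and $\varphi$ separates the sets $\mathbb{A}$ and $\mathbb{B}$.
   Context: Natural numbers include $0$. $\Phi$ is a set of proposition symbols. A pointed Kripke-model for $\Phi$ is a pair $(\mathcal{M},w)$ with $\mathcal{M}=(W,R,V)$, $R\subseteq W\times W$, $V:\Phi\to\mathcal{P}(W)$, $w\in W$. Formulas of $\mathrm{ML}(\Phi)$ (in negation normal form) are generated by $\varphi:=p\mid\neg p\mid(\varphi\wedge\varphi)\mid(\varphi\vee\varphi)\mid\Diamond\varphi\mid\Box\varphi$, $p\in\Phi$, with the usual Kripke semantics; the formulas $p,\neg p$ are the literals. (In the case $\Phi=\emptyset$ the constants $\top$, which is always true, and $\bot$, which is always false, are added and are the literals.) Modal size: $\mathrm{ms}(\varphi)=0$ for literals, $\mathrm{ms}(\psi\vee\vartheta)=\mathrm{ms}(\psi\wedge\vartheta)=\mathrm{ms}(\psi)+\mathrm{ms}(\vartheta)$, $\mathrm{ms}(\Diamond\psi)=\mathrm{ms}(\Box\psi)=\mathrm{ms}(\psi)+1$. Binary connective size: $\mathrm{cs}(\varphi)=0$ for literals, $\mathrm{cs}(\psi\vee\vartheta)=\mathrm{cs}(\psi\wedge\vartheta)=\mathrm{cs}(\psi)+\mathrm{cs}(\vartheta)+1$,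 $\mathrm{cs}(\Diamond\psi)=\mathrm{cs}(\Box\psi)=\mathrm{cs}(\psi)$. A formula $\varphi$ separates $\mathbb{A}$ and $\mathbb{B}$ if every element of $\mathbb{A}$ satisfies $\varphi$ and no element of $\mathbb{B}$ satisfies $\varphi$. Notation: $\Box(\mathcal{M},w)=\{(\mathcal{M},v)\mid wR^{\mathcal{M}}v\}$; $\Box\mathbb{A}=\bigcup_{(\mathcal{M},w)\in\mathbb{A}}\Box(\mathcal{M},w)$; for $f:\mathbb{A}\to\Box\mathbb{A}$ with $f(\mathcal{M},w)\in\Box(\mathcal{M},w)$ for all $(\mathcal{M},w)\in\mathbb{A}$, $\Diamond_f\mathbb{A}=f(\mathbb{A})$. The formula size game $\mathrm{FS}_{m_0,k_0}(\mathbb{A}_0,\mathbb{B}_0)$ has players S and D and starting position $(m_0,k_0,\mathbb{A}_0,\mathbb{B}_0)$. The game ends and S wins in a position $(m,k,\mathbb{A},\mathbb{B})$ if some literal separates $\mathbb{A}$ and $\mathbb{B}$. The game ends and D wins in a position with $m=k=0$ in which S does not win. Otherwise, in position $(m,k,\mathbb{A},\mathbb{B})$, S chooses one of the following moves (all parameters must be natural numbers). - Left splitting move: S chooses natural numbers $m_1,m_2,k_1,k_2$ and sets $\mathbb{A}_1,\mathbb{A}_2$ with $m_1+m_2=m$, $k_1+k_2+1=k$, $\mathbb{A}_1\cup\mathbb{A}_2=\mathbb{A}$; then D decides whether the game continues from $(m_1,k_1,\mathbb{A}_1,\mathbb{B})$ or from $(m_2,k_2,\mathbb{A}_2,\mathbb{B})$.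 - Right splitting move: S chooses natural numbers $m_1,m_2,k_1,k_2$ and sets $\mathbb{B}_1,\mathbb{B}_2$ with $m_1+m_2=m$, $k_1+k_2+1=k$, $\mathbb{B}_1\cup\mathbb{B}_2=\mathbb{B}$; then D decides whether the game continues from $(m_1,k_1,\mathbb{A},\mathbb{B}_1)$ or from $(m_2,k_2,\mathbb{A},\mathbb{B}_2)$. - Left successor move (needs $m\ge1$): S chooses $f:\mathbb{A}\to\Box\mathbb{A}$ with $f(\mathcal{A},w)\in\Box(\mathcal{A},w)$ for all $(\mathcal{A},w)\in\mathbb{A}$; the game continues from $(m-1,k,\Diamond_f\mathbb{A},\Box\mathbb{B})$. - Right successor move (needs $m\ge1$): S chooses $g:\mathbb{B}\to\Box\mathbb{B}$ with $g(\mathcal{B},w)\in\Box(\mathcal{B},w)$ for all $(\mathcal{B},w)\in\mathbb{B}$; the game continues from $(m-1,k,\Box\mathbb{A},\Diamond_g\mathbb{B})$. If $\Box(\mathcal{M},w)=\emptyset$ for some $(\mathcal{M},w)\in\mathbb{A}$ (resp. $\mathbb{B}$), S cannot make a left (resp. right) successor move. If S has not won and has no legal move, D wins. *)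

theory Defs
  imports Main "HOL-Library.FuncSet"
begin

section \<open>Kripke models\<close>

record ('w, 'p) kripke =
  worlds :: "'w set"
  acc :: "('w \<times> 'w) set"
  val :: "'p \<Rightarrow> 'w set"

type_synonym ('w, 'p) pointed = "('w, 'p) kripke \<times> 'w"

text \<open>The signature is a set rather than a type, since it may be empty. A valuation is a function
  on the signature only, hence the extensional function space.\<close>

definition pointed_models :: "'p set \<Rightarrow> ('w, 'p) pointed set" where
  "pointed_models \<Phi> = {(M, w). acc M \<subseteq> worlds M \<times> worlds M
     \<and> val M \<in> \<Phi> \<rightarrow>\<^sub>E Pow (worlds M) \<and> w \<in> worlds M}"

section \<open>Modal formulas in negation normal form\<close>

datatype 'p fm =
    Top
  | Bot
  | Prop 'p
  | NProp 'p
  | And "'p fm" "'p fm"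
  | Or "'p fm" "'p fm"
  | Dia "'p fm"
  | Box "'p fm"

definition literals :: "'p set \<Rightarrow> 'p fm set" where
  "literals \<Phi> = (if \<Phi> = {} then {Top, Bot} else Prop ` \<Phi> \<union> NProp ` \<Phi>)"

inductive_set modal_formulas :: "'p set \<Rightarrow> 'p fm set" for \<Phi> :: "'p set" where
  "\<phi> \<in> literals \<Phi> \<Longrightarrow> \<phi> \<in> modal_formulas \<Phi>"
| "\<phi> \<in> modal_formulas \<Phi> \<Longrightarrow> \<psi> \<in> modal_formulas \<Phi> \<Longrightarrow> And \<phi> \<psi> \<in> modal_formulas \<Phi>"
| "\<phi> \<in> modal_formulas \<Phi> \<Longrightarrow> \<psi> \<in> modal_formulas \<Phi> \<Longrightarrow> Or \<phi> \<psi> \<in> modal_formulas \<Phi>"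
| "\<phi> \<in> modal_formulas \<Phi> \<Longrightarrow> Dia \<phi> \<in> modal_formulas \<Phi>"
| "\<phi> \<in> modal_formulas \<Phi> \<Longrightarrow> Box \<phi> \<in> modal_formulas \<Phi>"

primrec sat :: "('w, 'p) kripke \<Rightarrow> 'w \<Rightarrow> 'p fm \<Rightarrow> bool" where
  "sat M w Top \<longleftrightarrow> True"
| "sat M w Bot \<longleftrightarrow> False"
| "sat M w (Prop p) \<longleftrightarrow> w \<in> val M p"
| "sat M w (NProp p) \<longleftrightarrow> w \<notin> val M p"
| "sat M w (And \<phi> \<psi>) \<longleftrightarrow> sat M w \<phi> \<and> sat M w \<psi>"
| "sat M w (Or \<phi> \<psi>) \<longleftrightarrow> sat M w \<phi> \<or> sat M w \<psi>"
| "sat M w (Dia \<phi>) \<longleftrightarrow> (\<exists>v. (w, v) \<in> acc M \<and> sat M v \<phi>)"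
| "sat M w (Box \<phi>) \<longleftrightarrow> (\<forall>v. (w, v) \<in> acc M \<longrightarrow> sat M v \<phi>)"

text \<open>Modal size and binary connective size.\<close>

primrec ms :: "'p fm \<Rightarrow> nat" where
  "ms Top = 0"
| "ms Bot = 0"
| "ms (Prop p) = 0"
| "ms (NProp p) = 0"
| "ms (And \<phi> \<psi>) = ms \<phi> + ms \<psi>"
| "ms (Or \<phi> \<psi>) = ms \<phi> + ms \<psi>"
| "ms (Dia \<phi>) = ms \<phi> + 1"
| "ms (Box \<phi>) = ms \<phi> + 1"

primrec cs :: "'p fm \<Rightarrow> nat" where
  "cs Top = 0"
| "cs Bot = 0"
| "cs (Prop p) = 0"
| "cs (NProp p) = 0"
| "cs (And \<phi> \<psi>) = cs \<phi> + cs \<psi> + 1"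
| "cs (Or \<phi> \<psi>) = cs \<phi> + cs \<psi> + 1"
| "cs (Dia \<phi>) = cs \<phi>"
| "cs (Box \<phi>) = cs \<phi>"

definition separates :: "'p fm \<Rightarrow> ('w, 'p) pointed set \<Rightarrow> ('w, 'p) pointed set \<Rightarrow> bool" where
  "separates \<phi> A B \<longleftrightarrow> (\<forall>(M, w) \<in> A. sat M w \<phi>) \<and> (\<forall>(M, w) \<in> B. \<not> sat M w \<phi>)"

section \<open>The formula size game\<close>

definition succs :: "('w, 'p) pointed \<Rightarrow> ('w, 'p) pointed set" where
  "succs = (\<lambda>(M, w). {(M, v) |v. (w, v) \<in> acc M})"

definition Succs :: "('w, 'p) pointed set \<Rightarrow> ('w, 'p) pointed set" where
  "Succs A = (\<Union>x\<in>A. succs x)"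

type_synonym ('w, 'p) position =
  "nat \<times> nat \<times> ('w, 'p) pointed set \<times> ('w, 'p) pointed set"

text \<open>In a splitting move the parameters are \<open>m\<^sub>1\<close>, \<open>m\<^sub>2\<close>, \<open>k\<^sub>1\<close>, \<open>k\<^sub>2\<close>
  and the two parts of the set that is split.\<close>

datatype ('w, 'p) move =
    Left_Split nat nat nat nat "('w, 'p) pointed set" "('w, 'p) pointed set"
  | Right_Split nat nat nat nat "('w, 'p) pointed set" "('w, 'p) pointed set"
  | Left_Succ "('w, 'p) pointed \<Rightarrow> ('w, 'p) pointed"
  | Right_Succ "('w, 'p) pointed \<Rightarrow> ('w, 'p) pointed"

fun legal :: "('w, 'p) position \<Rightarrow> ('w, 'p) move \<Rightarrow> bool" where
  "legal (m, k, A, B) (Left_Split m1 m2 k1 k2 A1 A2) \<longleftrightarrow>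
     m1 + m2 = m \<and> k1 + k2 + 1 = k \<and> A1 \<union> A2 = A"
| "legal (m, k, A, B) (Right_Split m1 m2 k1 k2 B1 B2) \<longleftrightarrow>
     m1 + m2 = m \<and> k1 + k2 + 1 = k \<and> B1 \<union> B2 = B"
| "legal (m, k, A, B) (Left_Succ f) \<longleftrightarrow> m \<ge> 1 \<and> f \<in> (\<Pi> x\<in>A. succs x)"
| "legal (m, k, A, B) (Right_Succ g) \<longleftrightarrow> m \<ge> 1 \<and> g \<in> (\<Pi> x\<in>B. succs x)"

text \<open>The positions among which D chooses after a move of S; there is a real choice only
  after splitting moves.\<close>

fun outcomes :: "('w, 'p) position \<Rightarrow> ('w, 'p) move \<Rightarrow> ('w, 'p) position set" where
  "outcomes (m, k, A, B) (Left_Split m1 m2 k1 k2 A1 A2) = {(m1, k1, A1, B), (m2, k2, A2, B)}"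
| "outcomes (m, k, A, B) (Right_Split m1 m2 k1 k2 B1 B2) = {(m1, k1, A, B1), (m2, k2, A, B2)}"
| "outcomes (m, k, A, B) (Left_Succ f) = {(m - 1, k, f ` A, Succs B)}"
| "outcomes (m, k, A, B) (Right_Succ g) = {(m - 1, k, Succs A, g ` B)}"

fun S_wins_at :: "'p set \<Rightarrow> ('w, 'p) position \<Rightarrow> bool" where
  "S_wins_at \<Phi> (m, k, A, B) \<longleftrightarrow> (\<exists>l \<in> literals \<Phi>. separates l A B)"

fun D_wins_at :: "'p set \<Rightarrow> ('w, 'p) position \<Rightarrow> bool" where
  "D_wins_at \<Phi> (m, k, A, B) \<longleftrightarrow> \<not> S_wins_at \<Phi> (m, k, A, B) \<and>
     (m = 0 \<and> k = 0 \<or> (\<nexists>mv. legal (m, k, A, B) mv))"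

definition ended :: "'p set \<Rightarrow> ('w, 'p) position \<Rightarrow> bool" where
  "ended \<Phi> P \<longleftrightarrow> S_wins_at \<Phi> P \<or> D_wins_at \<Phi> P"

text \<open>A strategy of S picks a move depending on the whole sequence of positions so far. The
  (partial) plays from \<open>P\<^sub>0\<close> in which S follows \<open>\<sigma>\<close>:\<close>

type_synonym ('w, 'p) strategy = "('w, 'p) position list \<Rightarrow> ('w, 'p) move"

inductive play :: "'p set \<Rightarrow> ('w, 'p) position \<Rightarrow> ('w, 'p) strategy \<Rightarrow> ('w, 'p) position list \<Rightarrow> bool"
  for \<Phi> P\<^sub>0 \<sigma> where
  start: "play \<Phi> P\<^sub>0 \<sigma> [P\<^sub>0]"
| step: "play \<Phi> P\<^sub>0 \<sigma> h \<Longrightarrow> \<not> ended \<Phi> (last h) \<Longrightarrow> legal (last h) (\<sigma> h) \<Longrightarrow>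
    Q \<in> outcomes (last h) (\<sigma> h) \<Longrightarrow> play \<Phi> P\<^sub>0 \<sigma> (h @ [Q])"

text \<open>\<open>\<sigma>\<close> is winning for S if it always supplies a legal move while the game is running, and every
  play following it that has ended is won by S. Nothing has to be said about infinite plays:
  there are none, by \<open>play_length\<close> below.\<close>

definition winning_strategy :: "'p set \<Rightarrow> ('w, 'p) position \<Rightarrow> ('w, 'p) strategy \<Rightarrow> bool" where
  "winning_strategy \<Phi> P\<^sub>0 \<sigma> \<longleftrightarrow> (\<forall>h. play \<Phi> P\<^sub>0 \<sigma> h \<longrightarrow>
     (\<not> ended \<Phi> (last h) \<longrightarrow> legal (last h) (\<sigma> h)) \<and>
     (ended \<Phi> (last h) \<longrightarrow> S_wins_at \<Phi> (last h)))"

lemma outcomes_decrease: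
  assumes "legal (m, k, A, B) mv" and "(m', k', A', B') \<in> outcomes (m, k, A, B) mv"
  shows "m' + k' < m + k"
  using assms by (cases mv) auto

lemma play_length:
  assumes "play \<Phi> (m, k, A, B) \<sigma> h"
  shows "length h \<le> Suc (m + k)"
proof -
  have "length h + fst (last h) + fst (snd (last h)) \<le> Suc (m + k)"
    using assms
  proof (induction rule: play.induct)
    case start
    show ?case by simp
  next
    case (step h Q)
    obtain m1 k1 A1 B1 where P: "last h = (m1, k1, A1, B1)" by (cases "last h")
    obtain m2 k2 A2 B2 where Q: "Q = (m2, k2, A2, B2)" by (cases Q)
    have "m2 + k2 < m1 + k1"
      using outcomes_decrease step.hyps(3,4) unfolding P Q by blast
    then show ?case using step.IH by (simp add: P Q)
  qed
  then show ?thesis by linarith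
qed

definition S_has_winning_strategy ::
    "'p set \<Rightarrow> nat \<Rightarrow> nat \<Rightarrow> ('w, 'p) pointed set \<Rightarrow> ('w, 'p) pointed set \<Rightarrow> bool" where
  "S_has_winning_strategy \<Phi> m k A B \<longleftrightarrow> (\<exists>\<sigma>. winning_strategy \<Phi> (m, k, A, B) \<sigma>)"

end

theory Submission
  imports Defs
begin

text \<open>Every play is finite, so S has a winning strategy iff the starting position lies in the
  inductively defined winning region of S. Derivations of membership in that region correspond to
  separating formulas: left and right splits are disjunctions and conjunctions, left and right
  successor moves are diamonds and boxes. Formulas smaller than the available resources are
  accommodated by handing the surplus to the second part of a split.\<close>

inductive S_winning :: "'p set \<Rightarrow> ('w, 'p) position \<Rightarrow> bool" for \<Phi> where
  literal: "S_wins_at \<Phi> P \<Longrightarrow> S_winning \<Phi> P"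
| move: "legal P mv \<Longrightarrow> \<forall>Q\<in>outcomes P mv. S_winning \<Phi> Q \<Longrightarrow> S_winning \<Phi> P"

text \<open>Every move spends a unit of \<open>m\<close> or of \<open>k\<close>, so no move is legal
  once both are \<open>0\<close>: if S has not won, the game has ended exactly when S is
  stuck.\<close>

lemma ended_iff: "ended \<Phi> P \<longleftrightarrow> S_wins_at \<Phi> P \<or> (\<nexists>mv. legal P mv)"
proof -
  obtain m k A B where P: "P = (m, k, A, B)" by (cases P)
  have "\<not> legal (0, 0, A, B) mv" for mv
    by (cases mv) auto
  then show ?thesis
    by (auto simp: P ended_def)
qed

text \<open>Stated for every partial play \<open>h\<close>, since \<open>\<sigma>\<close> may depend
  on the history; the starting position is the one-element play.\<close>

lemma winning_strategy_imp_S_winning: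
  assumes \<sigma>: "winning_strategy \<Phi> P \<sigma>" and "play \<Phi> P \<sigma> h"
  shows "S_winning \<Phi> (last h)"
  using assms(2)
\<comment> \<open>Backward induction on the resources \<open>m + k\<close> left at the end of the
  play, which strictly drop with each move.\<close>
proof (induction "fst (last h) + fst (snd (last h))" arbitrary: h rule: less_induct)
  case less
  show ?case
  proof (cases "ended \<Phi> (last h)")
    case True
    then show ?thesis
      using \<sigma> less.prems by (auto simp: winning_strategy_def intro: S_winning.literal)
  next
    case False
    then have legal: "legal (last h) (\<sigma> h)"
      using \<sigma> less.prems by (auto simp: winning_strategy_def)
    have "S_winning \<Phi> Q" if Q: "Q \<in> outcomes (last h) (\<sigma> h)" for Q
    proof -
      have "fst Q + fst (snd Q) < fst (last h) + fst (snd (last h))"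
        using outcomes_decrease legal Q by (metis prod.collapse)
      moreover have "play \<Phi> P \<sigma> (h @ [Q])"
        using less.prems False legal Q by (rule play.step)
      ultimately show ?thesis
        using less.hyps[of "h @ [Q]"] by simp
    qed
    then show ?thesis
      by (intro S_winning.move[OF legal] ballI)
  qed
qed

text \<open>A positional strategy is enough: always move so that every answer of D stays inside the
  region. Membership is then invariant along plays.\<close>

lemma S_winning_imp_winning_strategy:
  fixes P :: "('w, 'p) position"
  assumes "S_winning \<Phi> P"
  shows "\<exists>\<sigma>. winning_strategy \<Phi> P \<sigma>"
proof -
  define good where "good R mv \<longleftrightarrow> legal R mv \<and> (\<forall>Q\<in>outcomes R mv. S_winning \<Phi> Q)"
    for R :: "('w, 'p) position" and mv
  \<comment> \<open>The choice is arbitrary where no good move exists, but unfinished positions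
    reached in play lie in the region and have one.\<close>
  define \<sigma> where "\<sigma> h = (SOME mv. good (last h) mv)" for h
  have good: "good (last h) (\<sigma> h)" if "S_winning \<Phi> (last h)" "\<not> S_wins_at \<Phi> (last h)" for h
    using that(1)
  proof cases
    case literal
    with that(2) show ?thesis by contradiction
  next
    case (move mv)
    then have "good (last h) mv"
      by (simp add: good_def)
    then show ?thesis
      unfolding \<sigma>_def by (rule someI)
  qed
  have winning: "S_winning \<Phi> (last h)" if "play \<Phi> P \<sigma> h" for h
    using that
  proof (induction rule: play.induct)
    case start
    show ?case using assms by simp
  next
    case (step h Q)
    then show ?case using good[of h] by (auto simp: good_def ended_def)
  qed
  have "winning_strategy \<Phi> P \<sigma>"
    \<comment> \<open>A position that has ended without a win for S offers no legal move, whereas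
      \<open>good\<close> supplies one inside the region; so every finished play is won by
      S.\<close>
    unfolding winning_strategy_def using winning good by (auto simp: ended_iff good_def)
  then show ?thesis
    by (rule exI[where x = \<sigma>])
qed

lemma S_has_winning_strategy_iff:
  "S_has_winning_strategy \<Phi> m k A B \<longleftrightarrow> S_winning \<Phi> (m, k, A, B)"
proof
  assume "S_has_winning_strategy \<Phi> m k A B"
  then obtain \<sigma> where "winning_strategy \<Phi> (m, k, A, B) \<sigma>"
    unfolding S_has_winning_strategy_def by (rule exE)
  from winning_strategy_imp_S_winning[OF this play.start] show "S_winning \<Phi> (m, k, A, B)"
    by simp
next
  assume "S_winning \<Phi> (m, k, A, B)"
  then show "S_has_winning_strategy \<Phi> m k A B"
    unfolding S_has_winning_strategy_def by (rule S_winning_imp_winning_strategy)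
qed

lemma separates_Or:
  "separates \<phi> A\<^sub>1 B \<Longrightarrow> separates \<psi> A\<^sub>2 B \<Longrightarrow> separates (Or \<phi> \<psi>) (A\<^sub>1 \<union> A\<^sub>2) B"
  by (auto simp: separates_def)

lemma separates_And:
  "separates \<phi> A B\<^sub>1 \<Longrightarrow> separates \<psi> A B\<^sub>2 \<Longrightarrow> separates (And \<phi> \<psi>) A (B\<^sub>1 \<union> B\<^sub>2)"
  by (auto simp: separates_def)

text \<open>\<open>f x\<close> witnesses the diamond at each \<open>x\<close> in \<open>A\<close>;
  on the other side every successor must refute \<open>\<phi>\<close>, hence all of
  \<open>Succs B\<close>.\<close>

lemma separates_Dia:
  assumes "f \<in> (\<Pi> x\<in>A. succs x)" and "separates \<phi> (f ` A) (Succs B)"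
  shows "separates (Dia \<phi>) A B"
  using assms by (fastforce simp: separates_def succs_def Succs_def Pi_iff)

lemma separates_Box:
  assumes "g \<in> (\<Pi> x\<in>B. succs x)" and "separates \<phi> (Succs A) (g ` B)"
  shows "separates (Box \<phi>) A B"
  using assms by (fastforce simp: separates_def succs_def Succs_def Pi_iff)

text \<open>The points of \<open>A\<close> are distributed by which disjunct they satisfy, possibly
  both, as the parts may overlap; \<open>B\<close> refutes both disjuncts and stays whole.\<close>

lemma separates_OrE:
  assumes "separates (Or \<phi> \<psi>) A B"
  obtains A\<^sub>1 A\<^sub>2 where "A\<^sub>1 \<union> A\<^sub>2 = A" "separates \<phi> A\<^sub>1 B" "separates \<psi> A\<^sub>2 B"
proof
  show "{(M, w) \<in> A. sat M w \<phi>} \<union> {(M, w) \<in> A. sat M w \<psi>} = A"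
    using assms by (auto simp: separates_def)
qed (use assms in \<open>auto simp: separates_def\<close>)

text \<open>Dually, the points of \<open>B\<close> are distributed by which conjunct fails
  there.\<close>

lemma separates_AndE:
  assumes "separates (And \<phi> \<psi>) A B"
  obtains B\<^sub>1 B\<^sub>2 where "B\<^sub>1 \<union> B\<^sub>2 = B" "separates \<phi> A B\<^sub>1" "separates \<psi> A B\<^sub>2"
proof
  show "{(M, w) \<in> B. \<not> sat M w \<phi>} \<union> {(M, w) \<in> B. \<not> sat M w \<psi>} = B"
    using assms by (auto simp: separates_def)
qed (use assms in \<open>auto simp: separates_def\<close>)

lemma separates_DiaE:
  assumes "separates (Dia \<phi>) A B"
  obtains f where "f \<in> (\<Pi> x\<in>A. succs x)" "separates \<phi> (f ` A) (Succs B)"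
proof -
  have "\<forall>x\<in>A. \<exists>y\<in>succs x. sat (fst y) (snd y) \<phi>"
    using assms by (fastforce simp: separates_def succs_def)
  \<comment> \<open>The axiom of choice turns the witnessing successors into a function.\<close>
  then obtain f where "\<forall>x\<in>A. f x \<in> succs x \<and> sat (fst (f x)) (snd (f x)) \<phi>"
    by metis
  then show thesis
    using assms by (intro that[of f]) (fastforce simp: separates_def succs_def Succs_def)+
qed

text \<open>A box fails at \<open>x\<close> only through a refuting successor; \<open>g\<close>
  chooses one for each \<open>x\<close> in \<open>B\<close>.\<close>

lemma separates_BoxE:
  assumes "separates (Box \<phi>) A B"
  obtains g where "g \<in> (\<Pi> x\<in>B. succs x)" "separates \<phi> (Succs A) (g ` B)"
proof -
  have "\<forall>x\<in>B. \<exists>y\<in>succs x. \<not> sat (fst y) (snd y) \<phi>"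
    using assms by (fastforce simp: separates_def succs_def)
  then obtain g where "\<forall>x\<in>B. g x \<in> succs x \<and> \<not> sat (fst (g x)) (snd (g x)) \<phi>"
    by metis
  then show thesis
    using assms by (intro that[of g]) (fastforce simp: separates_def succs_def Succs_def)+
qed

lemma literal_size: "l \<in> literals \<Phi> \<Longrightarrow> ms l = 0 \<and> cs l = 0"
  by (auto simp: literals_def split: if_splits)

text \<open>The formula is read off the derivation of \<open>S_winning\<close>. \<open>ms\<close>
  and \<open>cs\<close> add up over a split just as the resources do, the \<open>+ 1\<close> in
  \<open>k\<close> paying for the connective.\<close>

lemma S_winning_imp_formula:
  assumes "S_winning \<Phi> (m, k, A, B)"
  shows "\<exists>\<phi>\<in>modal_formulas \<Phi>. ms \<phi> \<le> m \<and> cs \<phi> \<le> k \<and> separates \<phi> A B"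
  using assms
proof (induction "(m, k, A, B)" arbitrary: m k A B rule: S_winning.induct)
  case literal
  then obtain l where "l \<in> literals \<Phi>" "separates l A B"
    by auto
  then show ?case
    by (intro bexI[of _ l]) (simp_all add: literal_size modal_formulas.intros(1))
next
  case (move mv)
  have IH: "\<exists>\<phi>\<in>modal_formulas \<Phi>. ms \<phi> \<le> m' \<and> cs \<phi> \<le> k' \<and> separates \<phi> A' B'"
    if "(m', k', A', B') \<in> outcomes (m, k, A, B) mv" for m' k' A' B'
    using move.hyps(2) that by blast
  show ?case
  proof (cases mv)
    case (Left_Split m1 m2 k1 k2 A1 A2)
    with move.hyps(1) have eq: "m = m1 + m2" "k = k1 + k2 + 1" "A = A1 \<union> A2"
      by auto
    obtain \<phi> where \<phi>: "\<phi> \<in> modal_formulas \<Phi>" "ms \<phi> \<le> m1" "cs \<phi> \<le> k1" "separates \<phi> A1 B"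
      using IH[of m1 k1 A1 B] by (auto simp: Left_Split)
    obtain \<psi> where \<psi>: "\<psi> \<in> modal_formulas \<Phi>" "ms \<psi> \<le> m2" "cs \<psi> \<le> k2" "separates \<psi> A2 B"
      using IH[of m2 k2 A2 B] by (auto simp: Left_Split)
    show ?thesis
      using \<phi> \<psi> by (intro bexI[of _ "Or \<phi> \<psi>"]) (auto simp: eq intro: separates_Or modal_formulas.intros)
  next
    case (Right_Split m1 m2 k1 k2 B1 B2)
    with move.hyps(1) have eq: "m = m1 + m2" "k = k1 + k2 + 1" "B = B1 \<union> B2"
      by auto
    obtain \<phi> where \<phi>: "\<phi> \<in> modal_formulas \<Phi>" "ms \<phi> \<le> m1" "cs \<phi> \<le> k1" "separates \<phi> A B1"
      using IH[of m1 k1 A B1] by (auto simp: Right_Split)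
    obtain \<psi> where \<psi>: "\<psi> \<in> modal_formulas \<Phi>" "ms \<psi> \<le> m2" "cs \<psi> \<le> k2" "separates \<psi> A B2"
      using IH[of m2 k2 A B2] by (auto simp: Right_Split)
    show ?thesis
      using \<phi> \<psi> by (intro bexI[of _ "And \<phi> \<psi>"]) (auto simp: eq intro: separates_And modal_formulas.intros)
  next
    case (Left_Succ f)
    with move.hyps(1) have f: "1 \<le> m" "f \<in> (\<Pi> x\<in>A. succs x)"
      by auto
    obtain \<phi> where "\<phi> \<in> modal_formulas \<Phi>" "ms \<phi> \<le> m - 1" "cs \<phi> \<le> k"
        "separates \<phi> (f ` A) (Succs B)"
      using IH[of "m - 1" k "f ` A" "Succs B"] by (auto simp: Left_Succ)
    \<comment> \<open>\<open>1 \<le> m\<close> keeps \<open>m - 1\<close> from truncating, so the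
      added modality fits: \<open>ms \<phi> + 1 \<le> m\<close>.\<close>
    with f show ?thesis
      by (intro bexI[of _ "Dia \<phi>"]) (auto intro: separates_Dia modal_formulas.intros)
  next
    case (Right_Succ g)
    with move.hyps(1) have g: "1 \<le> m" "g \<in> (\<Pi> x\<in>B. succs x)"
      by auto
    obtain \<phi> where "\<phi> \<in> modal_formulas \<Phi>" "ms \<phi> \<le> m - 1" "cs \<phi> \<le> k"
        "separates \<phi> (Succs A) (g ` B)"
      using IH[of "m - 1" k "Succs A" "g ` B"] by (auto simp: Right_Succ)
    with g show ?thesis
      by (intro bexI[of _ "Box \<phi>"]) (auto intro: separates_Box modal_formulas.intros)
  qed
qed

text \<open>The budget and both sets vary in the induction, since subformulas are played for on
  other sets; the bounds are inequalities so that a surplus can be passed on.\<close>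

lemma formula_imp_S_winning:
  assumes "\<phi> \<in> modal_formulas \<Phi>" and "ms \<phi> \<le> m" "cs \<phi> \<le> k" "separates \<phi> A B"
  shows "S_winning \<Phi> (m, k, A, B)"
  using assms
proof (induction arbitrary: m k A B rule: modal_formulas.induct)
  case (1 \<phi>)
  then show ?case
    by (intro S_winning.literal) auto
next
  case (2 \<phi> \<psi>)
  obtain B1 B2 where B: "B1 \<union> B2 = B" "separates \<phi> A B1" "separates \<psi> A B2"
    using 2(7) by (rule separates_AndE)
  have "S_winning \<Phi> (ms \<phi>, cs \<phi>, A, B1)"
    using 2(3) B by simp
  \<comment> \<open>The \<open>- 1\<close> pays for the connective. The size bounds of the
    conjunction exclude truncation and leave at least \<open>ms \<psi>\<close> and
    \<open>cs \<psi>\<close>.\<close>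
  moreover have "S_winning \<Phi> (m - ms \<phi>, k - cs \<phi> - 1, A, B2)"
    using 2(4-6) B by simp
  ultimately show ?case
    using 2(5,6) B
    by (intro S_winning.move[where mv = "Right_Split (ms \<phi>) (m - ms \<phi>) (cs \<phi>) (k - cs \<phi> - 1) B1 B2"])
      auto
next
  case (3 \<phi> \<psi>)
  obtain A1 A2 where A: "A1 \<union> A2 = A" "separates \<phi> A1 B" "separates \<psi> A2 B"
    using 3(7) by (rule separates_OrE)
  have "S_winning \<Phi> (ms \<phi>, cs \<phi>, A1, B)"
    using 3(3) A by simp
  moreover have "S_winning \<Phi> (m - ms \<phi>, k - cs \<phi> - 1, A2, B)"
    using 3(4-6) A by simp
  ultimately show ?case
    using 3(5,6) A
    by (intro S_winning.move[where mv = "Left_Split (ms \<phi>) (m - ms \<phi>) (cs \<phi>) (k - cs \<phi> - 1) A1 A2"])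
      auto
next
  case (4 \<phi>)
  obtain f where "f \<in> (\<Pi> x\<in>A. succs x)" "separates \<phi> (f ` A) (Succs B)"
    using 4(5) by (rule separates_DiaE)
  \<comment> \<open>The bound on \<open>ms (Dia \<phi>)\<close> gives both \<open>m \<ge> 1\<close>,
    which makes the move legal, and \<open>ms \<phi> \<le> m - 1\<close> for the induction
    hypothesis.\<close>
  then show ?case
    using 4(2-4) by (intro S_winning.move[where mv = "Left_Succ f"]) auto
next
  case (5 \<phi>)
  obtain g where "g \<in> (\<Pi> x\<in>B. succs x)" "separates \<phi> (Succs A) (g ` B)"
    using 5(5) by (rule separates_BoxE)
  then show ?case
    using 5(2-4) by (intro S_winning.move[where mv = "Right_Succ g"]) auto
qed

theorem theorem3p2:
  fixes \<Phi> :: "'p set" and A B :: "('w, 'p) pointed set" and m k :: nat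
  assumes "A \<subseteq> pointed_models \<Phi>" and "B \<subseteq> pointed_models \<Phi>"
  shows "S_has_winning_strategy \<Phi> m k A B \<longleftrightarrow>
    (\<exists>\<phi> \<in> modal_formulas \<Phi>. ms \<phi> \<le> m \<and> cs \<phi> \<le> k \<and> separates \<phi> A B)"
  unfolding S_has_winning_strategy_iff
  by (auto intro: S_winning_imp_formula formula_imp_S_winning)

end
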